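(* Let $q$ be a prime power, $n$ a positive integer coprime to $q$, and $\alpha\in\overline{\mathbf{F}_q}^*$ an element of multiplicative order $n$. Let $C\subseteq\mathbf{F}_q^n$ be the cyclic code generated by a monic divisor $g\in\mathbf{F}_q[x]$ of $x^n-1$, with defining set $S\subseteq\{0,1,\dots,n-1\}$ (so $g=\prod_{i\in S}(x-\alpha^i)$). Let $T$ be a set of nonnegative integers with $T\subseteq S$, and let $t\ge 1$ be an integer. Suppose that $V(T,t)$ contains no point of the form $(\alpha^{i_1}:\alpha^{i_2}:\dots:\alpha^{i_t})$ with $i_1,\dots,i_t$ pairwise distinct modulo $n$. Then every nonzero codeword of $C$ has more than $t$ nonzero coordinates, i.e. the minimum distance of $C$ satisfies $d>t$.
   Context: The cyclic code: identify $V=\mathbf{F}_q[x]/(x^n-1)$ with $\mathbf{F}_q^n$ via $a_0+a_1x+\dots+a_{n-1}x^{n-1}\mapsto(a_0,\dots,a_{n-1})$; $C$ is the ideal of $V$ generated by $g$. The weight of a vector is its number of nonzero coordinates and $d$ is the minimum weight of a nonzero codeword. For a finite set $U$ of $m$ nonnegative integers and variables $x_1,\dots,x_m$, $\Delta[U]$ is the determinant of the $m\times m$ matrix whose rows are $(x_1^i,x_2^i,\dots,x_m^i)$ for $i\in U$ (in increasing order of $i$); $\Delta_m=\Delta[\{0,1,\dots,m-1\}]$ is the Vandermonde determinant, and $f[U]=\Delta[U]/\Delta_m$, a homogeneous polynomial with integer coefficients. For a set $T$ of nonnegative integers and $t\ge1$, $V(T,t)$ is the set of points $(x_1:\dots:x_t)\in\mathbf{P}^{t-1}(\overline{\mathbf{F}_q})$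 at which $f[U]$ (with coefficients reduced into $\mathbf{F}_q$) vanishes for every subset $U\subseteq T$ with $\#U=t$.
   Formalization: The condition t ≤ n is added: for t > n no t exponents are pairwise distinct modulo n, so the hypothesis on V(T,t) is vacuous while no word of length n has weight above t, and the claim fails for every nonzero code C. *)

theory Defs
  imports
    "HOL-Number_Theory.Number_Theory"
    "HOL-Number_Theory.Prime_Powers"
    "HOL-Algebra.Algebra"
    "HOL-Algebra.Algebraic_Closure_Type"
    "HOL-Library.Poly_Mapping"
    "HOL-Library.Extended_Nat"
    "Jordan_Normal_Form.Determinant"
begin

section \<open>Cyclic codes\<close>

abbreviation univ_poly_ring :: "'a::field poly ring" where
  "univ_poly_ring \<equiv> ring_of_type_algebra"

definition cyc_ideal :: "nat \<Rightarrow> 'a::field poly set" where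
  "cyc_ideal n = genideal univ_poly_ring {Polynomial.monom 1 n - 1}"

definition cyc_ring :: "nat \<Rightarrow> 'a::field poly set ring" where
  "cyc_ring n = univ_poly_ring Quot (cyc_ideal n)"

definition cyc_class :: "nat \<Rightarrow> 'a::field poly \<Rightarrow> 'a poly set" where
  "cyc_class n p = cyc_ideal n +>\<^bsub>univ_poly_ring\<^esub> p"

definition poly_of_coords :: "'a::field vec \<Rightarrow> 'a poly" where
  "poly_of_coords v = (\<Sum>i<dim_vec v. Polynomial.monom (v $ i) i)"

definition cyclic_code :: "nat \<Rightarrow> 'a::field poly \<Rightarrow> 'a vec set" where
  "cyclic_code n g =
     {v \<in> carrier_vec n.
        cyc_class n (poly_of_coords v) \<in> genideal (cyc_ring n) {cyc_class n g}}"

definition weight :: "'a::zero vec \<Rightarrow> nat" where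
  "weight v = card {i. i < dim_vec v \<and> v $ i \<noteq> 0}"

text \<open>The minimum over the empty set is \<open>\<infinity>\<close>, so the zero code has infinite minimum distance.\<close>

definition min_distance :: "nat \<Rightarrow> 'a::zero vec set \<Rightarrow> enat" where
  "min_distance n C = (INF v\<in>C - {0\<^sub>v n}. enat (weight v))"


section \<open>Generalised Vandermonde determinants\<close>

text \<open>
  Integer polynomials in variables indexed by the natural numbers: a polynomial maps monomials
  (finitely supported exponent functions) to coefficients. The ring structure is that
  of \<open>Poly_Mapping\<close>. The variables \<open>x\<^sub>1, \<dots>, x\<^sub>m\<close> are \<open>mvar 0, \<dots>, mvar (m - 1)\<close>.
\<close>

type_synonym int_mpoly = "(nat \<Rightarrow>\<^sub>0 nat) \<Rightarrow>\<^sub>0 int"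

definition mvar :: "nat \<Rightarrow> int_mpoly" where
  "mvar j = Poly_Mapping.single (Poly_Mapping.single j 1) 1"

definition Delta :: "nat set \<Rightarrow> int_mpoly" where
  "Delta U = det (mat (card U) (card U) (\<lambda>(r, c). mvar c ^ (sorted_list_of_set U ! r)))"

text \<open>
  The quotient of \<open>Delta U\<close> by the Vandermonde determinant is exact, and unique because the
  polynomial ring is an integral domain.
\<close>

definition schur_quot :: "nat set \<Rightarrow> int_mpoly" where
  "schur_quot U = (THE f. f * Delta {0..<card U} = Delta U)"

definition eval_mpoly :: "(nat \<Rightarrow> 'a::field alg_closure) \<Rightarrow> int_mpoly \<Rightarrow> 'a alg_closure" where
  "eval_mpoly x f =
     (\<Sum>m\<in>Poly_Mapping.keys f.
        to_ac (of_int (Poly_Mapping.lookup f m)) *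
        (\<Prod>j\<in>Poly_Mapping.keys m. x j ^ Poly_Mapping.lookup m j))"


section \<open>Projective points\<close>

definition proj_point :: "'a::field vec \<Rightarrow> 'a vec set" where
  "proj_point x = {c \<cdot>\<^sub>v x | c. c \<noteq> 0}"

definition proj_points :: "nat \<Rightarrow> 'a::field vec set set" where
  "proj_points t = proj_point ` (carrier_vec t - {0\<^sub>v t})"

text \<open>Homogeneous coordinates \<open>(x\<^sub>1 : \<dots> : x\<^sub>t)\<close> are numbered from \<open>0\<close>. As \<open>schur_quot U\<close> is
  homogeneous, vanishing at one representative of a point is vanishing at all of them.\<close>

definition vanishing_locus :: "nat set \<Rightarrow> nat \<Rightarrow> 'a::field alg_closure vec set set" where
  "vanishing_locus T t =
     {P \<in> proj_points t.
        \<forall>U. U \<subseteq> T \<and> finite U \<and> card U = t \<longrightarrow> (\<forall>x\<in>P. eval_mpoly (vec_index x) (schur_quot U) = 0)}"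

end

theory Submission
  imports Defs
begin

text \<open>
  Pad the support of a nonzero codeword of weight at most \<open>t\<close> to \<open>t\<close> positions
  \<open>i\<^sub>1, \<dots>, i\<^sub>t\<close>. The parity checks at the exponents in \<open>T\<close> make the coordinates of the codeword a
  kernel vector of every generalised Vandermonde matrix with nodes \<open>\<alpha> ^ i\<^sub>j\<close> and exponents
  \<open>U \<subseteq> T\<close>. Its determinant therefore vanishes, while the ordinary Vandermonde determinant of the
  distinct nodes does not, so the quotient vanishes at the point.

  That the quotient exists as an integer polynomial follows from Newton interpolation: a generalised
  Vandermonde matrix is a matrix of divided differences times the upper triangular matrix of Newton
  basis values, and the determinant of the latter is the Vandermonde determinant.
\<close>

section \<open>Newton factorisation of generalised Vandermonde matrices\<close>

text \<open>\<open>newton_coeff x u k\<close> is the divided difference of \<open>y \<mapsto> y ^ u\<close> at \<open>x 0, \<dots>, x k\<close>.\<close>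

fun newton_coeff :: "(nat \<Rightarrow> 'a::comm_ring_1) \<Rightarrow> nat \<Rightarrow> nat \<Rightarrow> 'a" where
  "newton_coeff x 0 k = (if k = 0 then 1 else 0)"
| "newton_coeff x (Suc u) k =
     x k * newton_coeff x u k + (case k of 0 \<Rightarrow> 0 | Suc j \<Rightarrow> newton_coeff x u j)"

lemma newton_coeff_eq_0: "u < k \<Longrightarrow> newton_coeff x u k = 0"
  by (induction u arbitrary: k) (auto split: nat.split)

lemma newton_coeff_self: "newton_coeff x u u = 1"
  by (induction u) (auto simp: newton_coeff_eq_0)

text \<open>Newton interpolation: with \<open>N k\<close> the product of \<open>y - x l\<close> over
  \<open>l < k\<close>, the recursion of \<open>newton_coeff\<close> mirrors
  \<open>y * N k = x k * N k + N (Suc k)\<close>, so the expansion for \<open>u\<close> times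
  \<open>y\<close> is the one for \<open>Suc u\<close>.\<close>

lemma power_eq_sum_newton_coeff:
  fixes y :: "'a::comm_ring_1"
  shows "u \<le> m \<Longrightarrow> y ^ u = (\<Sum>k\<le>m. newton_coeff x u k * (\<Prod>l<k. y - x l))"
proof (induction u arbitrary: m)
  case 0
  have "(\<Sum>k\<le>m. newton_coeff x 0 k * (\<Prod>l<k. y - x l)) = (\<Sum>k\<in>{0}. newton_coeff x 0 k * (\<Prod>l<k. y - x l))"
    by (rule sum.mono_neutral_right) auto
  then show ?case by simp
next
  case (Suc u)
  then obtain m' where m: "m = Suc m'" and um: "u \<le> m'" by (cases m) auto
  let ?N = "\<lambda>k. \<Prod>l<k. y - x l"
  have shift: "(\<Sum>k\<le>m. (case k of 0 \<Rightarrow> 0 | Suc j \<Rightarrow> newton_coeff x u j) * ?N k)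
      = (\<Sum>k\<le>m'. newton_coeff x u k * ?N (Suc k))"
    unfolding m by (subst sum.atMost_Suc_shift) simp
  have "(\<Sum>k\<le>m. newton_coeff x (Suc u) k * ?N k)
      = (\<Sum>k\<le>m. x k * newton_coeff x u k * ?N k) + (\<Sum>k\<le>m'. newton_coeff x u k * ?N (Suc k))"
    unfolding newton_coeff.simps distrib_right sum.distrib shift ..
  \<comment> \<open>The top term \<open>k = m\<close> vanishes because \<open>u < m\<close>; both
    sums then run up to \<open>m'\<close> and can be merged termwise.\<close>
  also have "(\<Sum>k\<le>m. x k * newton_coeff x u k * ?N k) = (\<Sum>k\<le>m'. x k * newton_coeff x u k * ?N k)"
    using um by (simp add: m newton_coeff_eq_0)
  also have "\<dots> + (\<Sum>k\<le>m'. newton_coeff x u k * ?N (Suc k)) = y * (\<Sum>k\<le>m'. newton_coeff x u k * ?N k)"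
    unfolding sum_distrib_left sum.distrib[symmetric]
    by (rule sum.cong) (auto simp: algebra_simps)
  also have "\<dots> = y ^ Suc u"
    using Suc.IH[OF um] by simp
  finally show ?case by simp
qed

text \<open>Exponents are a function and the ring is arbitrary, so the same matrix serves for
  \<open>Delta U\<close>, for the ordinary Vandermonde determinant and for their values at a
  point.\<close>

definition gen_vandermonde_mat :: "nat \<Rightarrow> (nat \<Rightarrow> 'a::comm_ring_1) \<Rightarrow> (nat \<Rightarrow> nat) \<Rightarrow> 'a mat" where
  "gen_vandermonde_mat n x u = mat n n (\<lambda>(r, c). x c ^ u r)"

definition newton_mat :: "nat \<Rightarrow> (nat \<Rightarrow> 'a::comm_ring_1) \<Rightarrow> (nat \<Rightarrow> nat) \<Rightarrow> 'a mat" where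
  "newton_mat n x u = mat n n (\<lambda>(r, k). newton_coeff x (u r) k)"

definition newton_basis_mat :: "nat \<Rightarrow> (nat \<Rightarrow> 'a::comm_ring_1) \<Rightarrow> 'a mat" where
  "newton_basis_mat n x = mat n n (\<lambda>(k, c). \<Prod>l<k. x c - x l)"

lemma gen_vandermonde_mat_factor:
  "gen_vandermonde_mat n x u = newton_mat n x u * newton_basis_mat n x"
proof (rule eq_matI)
  fix r c
  assume "r < dim_row (newton_mat n x u * newton_basis_mat n x)"
    and "c < dim_col (newton_mat n x u * newton_basis_mat n x)"
  then have r: "r < n" and c: "c < n" by (auto simp: newton_mat_def newton_basis_mat_def)
  let ?f = "\<lambda>k. newton_coeff x (u r) k * (\<Prod>l<k. x c - x l)"
  \<comment> \<open>The bound \<open>u r + n\<close> is large enough for the expansion of the power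
    and for the range to contain all of \<open>{0..<n}\<close>.\<close>
  have "x c ^ u r = (\<Sum>k\<le>u r + n. ?f k)"
    by (rule power_eq_sum_newton_coeff) simp
  also have "\<dots> = (\<Sum>k\<in>{0..<n}. ?f k)"
  proof (rule sum.mono_neutral_right)
    show "\<forall>k\<in>{..u r + n} - {0..<n}. ?f k = 0"
    proof
      fix k assume "k \<in> {..u r + n} - {0..<n}"
      \<comment> \<open>For \<open>k \<ge> n\<close> the node \<open>x c\<close> is among those
        already used, so the product contains the factor \<open>x c - x c\<close>.\<close>
      then have "c < k" using c by auto
      then have "(\<Prod>l<k. x c - x l) = 0" by (intro prod_zero) auto
      then show "?f k = 0" by simp
    qed
  qed auto
  finally show "gen_vandermonde_mat n x u $$ (r, c) = (newton_mat n x u * newton_basis_mat n x) $$ (r, c)"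
    using r c by (simp add: gen_vandermonde_mat_def newton_mat_def newton_basis_mat_def scalar_prod_def)
qed (auto simp: gen_vandermonde_mat_def newton_mat_def newton_basis_mat_def)

lemma det_gen_vandermonde_mat:
  "det (gen_vandermonde_mat n x u) = det (newton_mat n x u) * det (newton_basis_mat n x)"
  unfolding gen_vandermonde_mat_factor
  by (rule det_mult[of _ n]) (auto simp: newton_mat_def newton_basis_mat_def)

text \<open>For exponents \<open>0, ..., n - 1\<close> the matrix is lower unitriangular: each power
  is a monic combination of Newton basis polynomials.\<close>

lemma det_newton_mat_id: "det (newton_mat n x (\<lambda>r. r)) = 1"
proof -
  have "det (newton_mat n x (\<lambda>r. r)) = prod_list (diag_mat (newton_mat n x (\<lambda>r. r)))"
    by (rule det_lower_triangular[of n]) (auto simp: newton_mat_def newton_coeff_eq_0)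
  also have "\<dots> = 1"
    unfolding prod_list_diag_prod by (rule prod.neutral) (auto simp: newton_mat_def newton_coeff_self)
  finally show ?thesis .
qed

lemma det_newton_basis_mat: "det (newton_basis_mat n x) = (\<Prod>c<n. \<Prod>l<c. x c - x l)"
proof -
  have "det (newton_basis_mat n x) = prod_list (diag_mat (newton_basis_mat n x))"
  proof (rule det_upper_triangular[of _ n])
    show "upper_triangular (newton_basis_mat n x)"
    proof (rule upper_triangularI)
      fix i j assume ji: "j < i" and "i < dim_row (newton_basis_mat n x)"
      then have "i < n" by (simp add: newton_basis_mat_def)
      moreover have "(\<Prod>l<i. x j - x l) = 0" using ji by (intro prod_zero) auto
      ultimately show "newton_basis_mat n x $$ (i, j) = 0"
        using ji by (simp add: newton_basis_mat_def)
    qed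
  qed (auto simp: newton_basis_mat_def)
  also have "\<dots> = (\<Prod>c<n. \<Prod>l<c. x c - x l)"
    unfolding prod_list_diag_prod by (rule prod.cong) (auto simp: newton_basis_mat_def)
  finally show ?thesis .
qed

lemma det_vandermonde_mat:
  "det (gen_vandermonde_mat n x (\<lambda>r. r)) = (\<Prod>c<n. \<Prod>l<c. x c - x l)"
  by (simp add: det_gen_vandermonde_mat det_newton_mat_id det_newton_basis_mat)

lemma det_vandermonde_mat_neq_0:
  fixes x :: "nat \<Rightarrow> 'a::idom"
  assumes "inj_on x {..<n}"
  shows "det (gen_vandermonde_mat n x (\<lambda>r. r)) \<noteq> 0"
proof
  assume "det (gen_vandermonde_mat n x (\<lambda>r. r)) = 0"
  then obtain c l where "c < n" "l < c" "x c = x l" by (auto simp: det_vandermonde_mat)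
  then show False using inj_onD[OF assms, of c l] by simp
qed

text \<open>Both determinants contain the factor \<open>det (newton_basis_mat n x)\<close>, and for
  the ordinary Vandermonde matrix the other factor is 1. The quotient is
  \<open>det (newton_mat n x u)\<close>.\<close>

lemma det_vandermonde_mat_dvd:
  "det (gen_vandermonde_mat n x (\<lambda>r. r)) dvd det (gen_vandermonde_mat n x u)"
  by (simp add: det_gen_vandermonde_mat det_newton_mat_id)


section \<open>The quotient of \<open>Delta U\<close> by the Vandermonde determinant\<close>

lemma Delta_eq_det: "Delta U = det (gen_vandermonde_mat (card U) mvar ((!) (sorted_list_of_set U)))"
  unfolding Delta_def gen_vandermonde_mat_def ..

lemma Delta_initial_segment: "Delta {0..<m} = det (gen_vandermonde_mat m mvar (\<lambda>r. r))"
  unfolding Delta_def gen_vandermonde_mat_def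
  by (intro arg_cong[where f = det] cong_mat) auto

lemma inj_mvar: "inj mvar"
proof
  fix i j :: nat
  assume "mvar i = mvar j"
  then have "Poly_Mapping.keys (mvar i) = Poly_Mapping.keys (mvar j)" by simp
  then have "Poly_Mapping.single i (1::nat) = Poly_Mapping.single j 1" by (simp add: mvar_def)
  then have "Poly_Mapping.keys (Poly_Mapping.single i (1::nat)) = Poly_Mapping.keys (Poly_Mapping.single j (1::nat))"
    by simp
  then show "i = j" by simp
qed

text \<open>Justifies the definite description: divisibility gives existence, and cancelling the
  nonzero Vandermonde determinant of the distinct variables gives uniqueness.\<close>

lemma schur_quot_mult_Delta: "schur_quot U * Delta {0..<card U} = Delta U"
proof -
  have nz: "Delta {0..<card U} \<noteq> 0"
    unfolding Delta_initial_segment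
    by (rule det_vandermonde_mat_neq_0) (rule inj_on_subset[OF inj_mvar subset_UNIV])
  have "Delta {0..<card U} dvd Delta U"
    unfolding Delta_initial_segment Delta_eq_det[of U] by (rule det_vandermonde_mat_dvd)
  then obtain f where f: "f * Delta {0..<card U} = Delta U"
    by (metis dvdE mult.commute)
  have "\<exists>!f. f * Delta {0..<card U} = Delta U"
    using f nz by (metis mult_right_cancel)
  then show ?thesis unfolding schur_quot_def by (rule theI')
qed


section \<open>Evaluation of integer polynomials\<close>

definition eval_monom :: "(nat \<Rightarrow> 'a::comm_ring_1) \<Rightarrow> (nat \<Rightarrow>\<^sub>0 nat) \<Rightarrow> 'a" where
  "eval_monom x m = (\<Prod>j\<in>Poly_Mapping.keys m. x j ^ Poly_Mapping.lookup m j)"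

text \<open>Additional indices have exponent 0 and contribute 1, so monomials with different
  supports can be compared over one index set.\<close>

lemma eval_monom_superset:
  assumes "finite A" "Poly_Mapping.keys m \<subseteq> A"
  shows "eval_monom x m = (\<Prod>j\<in>A. x j ^ Poly_Mapping.lookup m j)"
  unfolding eval_monom_def using assms
  by (intro prod.mono_neutral_left) (auto simp: in_keys_iff)

lemma eval_monom_add: "eval_monom x (m + m') = eval_monom x m * eval_monom x m'"
proof -
  let ?A = "Poly_Mapping.keys m \<union> Poly_Mapping.keys m'"
  have "eval_monom x (m + m') = (\<Prod>j\<in>?A. x j ^ Poly_Mapping.lookup (m + m') j)"
    by (rule eval_monom_superset) (simp_all add: Poly_Mapping.keys_add)
  also have "\<dots> = (\<Prod>j\<in>?A. x j ^ Poly_Mapping.lookup m j) * (\<Prod>j\<in>?A. x j ^ Poly_Mapping.lookup m' j)"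
    by (simp add: lookup_add power_add prod.distrib)
  also have "\<dots> = eval_monom x m * eval_monom x m'"
    by (simp add: eval_monom_superset[of ?A])
  finally show ?thesis .
qed

lemma eval_mpoly_eq:
  "eval_mpoly x f = (\<Sum>m\<in>Poly_Mapping.keys f. of_int (Poly_Mapping.lookup f m) * eval_monom x m)"
  by (simp add: eval_mpoly_def eval_monom_def)

lemma eval_mpoly_add: "eval_mpoly x (f + g) = eval_mpoly x f + eval_mpoly x g"
  unfolding eval_mpoly_eq
  by (rule setsum_keys_plus_distrib[where f = "\<lambda>m a. of_int a * eval_monom x m"])
     (simp_all add: distrib_right)

lemma eval_mpoly_single: "eval_mpoly x (Poly_Mapping.single m a) = of_int a * eval_monom x m"
  by (cases "a = 0") (simp_all add: eval_mpoly_eq)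

lemma int_mpoly_induct [case_names zero add]:
  fixes f :: int_mpoly
  assumes "P 0" and "\<And>m a f. P f \<Longrightarrow> P (Poly_Mapping.single m a + f)"
  shows "P f"
proof (induction f rule: update_induct)
  case (update f m a)
  \<comment> \<open>The updated monomial is absent from \<open>f\<close>, so overwriting its
    coefficient amounts to adding one term.\<close>
  then have "Poly_Mapping.update m a f = Poly_Mapping.single m a + f"
    by (intro poly_mapping_eqI)
       (auto simp: lookup_update lookup_add lookup_single in_keys_iff when_def)
  then show ?case using assms(2) update by simp
qed (rule assms(1))

lemma eval_mpoly_0: "eval_mpoly x 0 = 0"
  by (simp add: eval_mpoly_eq)

lemma eval_mpoly_single_mult:
  "eval_mpoly x (Poly_Mapping.single m a * g) = of_int a * eval_monom x m * eval_mpoly x g"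
  by (induction g rule: int_mpoly_induct)
     (simp_all add: eval_mpoly_0 eval_mpoly_add eval_mpoly_single mult_single eval_monom_add
        algebra_simps)

lemma eval_mpoly_mult: "eval_mpoly x (f * g) = eval_mpoly x f * eval_mpoly x g"
  by (induction f rule: int_mpoly_induct)
     (simp_all add: eval_mpoly_0 eval_mpoly_add eval_mpoly_single eval_mpoly_single_mult
        distrib_right)

lemma eval_mpoly_1: "eval_mpoly x 1 = 1"
proof -
  have "eval_mpoly x (Poly_Mapping.single 0 1) = 1"
    unfolding eval_mpoly_single by (simp add: eval_monom_def)
  then show ?thesis by simp
qed

lemma eval_mpoly_mvar: "eval_mpoly x (mvar j) = x j"
  by (simp add: mvar_def eval_mpoly_single eval_monom_def)

lemma comm_ring_hom_eval_mpoly: "comm_ring_hom (eval_mpoly x)"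
  by unfold_locales (auto simp: eval_mpoly_add eval_mpoly_0 eval_mpoly_mult eval_mpoly_1)

text \<open>Evaluation is a ring homomorphism, hence commutes with determinants, and it sends the
  node \<open>mvar j\<close> to \<open>x j\<close>.\<close>

lemma eval_mpoly_det_gen_vandermonde:
  "eval_mpoly x (det (gen_vandermonde_mat n mvar u)) = det (gen_vandermonde_mat n x u)"
proof -
  interpret comm_ring_hom "eval_mpoly x" by (rule comm_ring_hom_eval_mpoly)
  show ?thesis
    unfolding hom_det[symmetric] gen_vandermonde_mat_def
    by (intro arg_cong[where f = det] eq_matI) (auto simp: hom_power eval_mpoly_mvar)
qed

text \<open>Evaluate the defining product: its right side is 0, while distinct nodes make the
  Vandermonde factor nonzero.\<close>

lemma eval_schur_quot_eq_0:
  assumes "inj_on x {..<card U}"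
    and "det (gen_vandermonde_mat (card U) x ((!) (sorted_list_of_set U))) = 0"
  shows "eval_mpoly x (schur_quot U) = 0"
proof -
  have "eval_mpoly x (schur_quot U) * eval_mpoly x (Delta {0..<card U}) = eval_mpoly x (Delta U)"
    by (simp flip: eval_mpoly_mult add: schur_quot_mult_Delta)
  then show ?thesis
    using assms(2) det_vandermonde_mat_neq_0[OF assms(1)]
    by (simp add: Delta_eq_det[of U] Delta_initial_segment eval_mpoly_det_gen_vandermonde)
qed


section \<open>Cyclic codes\<close>

text \<open>Membership in the ideal generated by the class of \<open>g\<close> lifts to an identity
  \<open>b * (x ^ n - 1) + a * g\<close> for the codeword polynomial, and \<open>g\<close> divides
  both summands.\<close>

lemma cyclic_code_imp_dvd:
  fixes g :: "'a::field poly"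
  assumes v: "v \<in> cyclic_code n g" and g: "g dvd Polynomial.monom 1 n - 1"
  shows "g dvd poly_of_coords v"
proof -
  let ?R = "ring_of_type_algebra :: 'a poly ring"
  let ?I = "cyc_ideal n :: 'a poly set"
  let ?m = "Polynomial.monom 1 n - 1 :: 'a poly"
  interpret R: cring ?R by (rule cring_from_type_algebra)
  have carr [simp]: "carrier ?R = UNIV" and mult [simp]: "a \<otimes>\<^bsub>?R\<^esub> b = a * b"
    and add [simp]: "a \<oplus>\<^bsub>?R\<^esub> b = a + b" for a b :: "'a poly"
    by (simp_all add: ring_of_type_algebra_def)
  interpret I: ideal ?I ?R unfolding cyc_ideal_def by (rule R.genideal_ideal) simp
  interpret Q: cring "cyc_ring n :: 'a poly set ring"
    unfolding cyc_ring_def by (rule I.quotient_is_cring) (rule R.is_cring)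
  have I_eq: "?I = {b * ?m | b. True}"
    unfolding cyc_ideal_def R.cgenideal_eq_genideal[of ?m, simplified, symmetric]
    by (simp add: cgenideal_def)
  have class_carr: "cyc_class n p \<in> carrier (cyc_ring n)" for p :: "'a poly"
    unfolding cyc_class_def cyc_ring_def FactRing_def by (simp add: R.a_rcosetsI)
  have "cyc_class n (poly_of_coords v) \<in> genideal (cyc_ring n) {cyc_class n g}"
    using v by (simp add: cyclic_code_def)
  \<comment> \<open>The ideal is principal in the quotient ring too, so membership yields a cofactor
    \<open>A\<close>, which is then represented by a polynomial \<open>a\<close>.\<close>
  then have "\<exists>A\<in>carrier (cyc_ring n). cyc_class n (poly_of_coords v) = A \<otimes>\<^bsub>cyc_ring n\<^esub> cyc_class n g"
    using Q.cgenideal_eq_genideal[OF class_carr[of g]] by (auto simp: cgenideal_def)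
  then obtain A where A: "A \<in> carrier (cyc_ring n)"
    and eq: "cyc_class n (poly_of_coords v) = A \<otimes>\<^bsub>cyc_ring n\<^esub> cyc_class n g"
    by blast
  from A obtain a where a: "A = cyc_class n a"
    by (auto simp: cyc_ring_def FactRing_def A_RCOSETS_def' cyc_class_def)
  have "?I +>\<^bsub>?R\<^esub> poly_of_coords v = ?I +>\<^bsub>?R\<^esub> (a * g)"
    using eq I.rcoset_mult_add[of a g] by (simp add: a cyc_ring_def FactRing_def cyc_class_def)
  then have "poly_of_coords v \<in> ?I +>\<^bsub>?R\<^esub> (a * g)"
    using I.a_rcos_self[of "poly_of_coords v"] by simp
  then obtain b where "poly_of_coords v = b * ?m + a * g"
    by (auto simp: a_r_coset_def' I_eq)
  then show ?thesis using g by simp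
qed

lemma poly_map_poly_to_ac_of_coords:
  fixes v :: "'a::field vec"
  shows
  "poly (map_poly to_ac (poly_of_coords v)) z = (\<Sum>i<dim_vec v. to_ac (v $ i) * z ^ i)"
proof -
  have "map_poly to_ac (poly_of_coords v) = (\<Sum>i<dim_vec v. Polynomial.monom (to_ac (v $ i)) i)"
    by (intro poly_eqI)
       (simp add: coeff_map_poly poly_of_coords_def Polynomial.coeff_sum to_ac_sum if_distrib)
  then show ?thesis by (simp add: poly_sum poly_monom)
qed

lemma cyclic_code_parity_check:
  fixes g :: "'a::field poly"
    and v :: "'a vec"
  assumes v: "v \<in> cyclic_code n g" and g: "g dvd Polynomial.monom 1 n - 1"
    and z: "poly (map_poly to_ac g) z = 0"
  shows "(\<Sum>i<n. to_ac (v $ i) * z ^ i) = 0"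
proof -
  obtain h where h: "poly_of_coords v = g * h"
    using cyclic_code_imp_dvd[OF v g] by (auto elim: dvdE)
  have "map_poly to_ac (g * h) = map_poly to_ac g * map_poly to_ac h"
    by (intro poly_eqI) (simp add: coeff_map_poly coeff_mult to_ac_sum)
  then have "poly (map_poly to_ac (poly_of_coords v)) z = 0" using z by (simp add: h)
  moreover have "dim_vec v = n" using v by (auto simp: cyclic_code_def)
  ultimately show ?thesis by (simp add: poly_map_poly_to_ac_of_coords)
qed

lemma power_eq_iff_cong_ord:
  fixes a :: "'a::field"
  assumes "a \<noteq> 0"
  shows "a ^ i = a ^ j \<longleftrightarrow>
    [i = j] (mod group.ord (Multiplicative_Group.mult_of (ring_of_type_algebra :: 'a ring)) a)"
proof -
  let ?R = "ring_of_type_algebra :: 'a ring"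
  interpret F: field ?R by (rule field_from_type_algebra)
  interpret G: group "Multiplicative_Group.mult_of ?R" by (rule F.field_mult_group)
  have a: "a \<in> carrier (Multiplicative_Group.mult_of ?R)" using assms by (simp add: ring_of_type_algebra_def)
  \<comment> \<open>The factors are swapped because the group power appends the new factor on the
    right, while \<open>a ^ Suc k\<close> puts it on the left.\<close>
  have mult: "x \<otimes>\<^bsub>?R\<^esub> y = y * x" for x y
    by (simp add: ring_of_type_algebra_def mult.commute)
  have one: "\<one>\<^bsub>?R\<^esub> = 1" by (simp add: ring_of_type_algebra_def)
  have pow: "a [^]\<^bsub>Multiplicative_Group.mult_of ?R\<^esub> (k::nat) = a ^ k" for k
    by (induction k) (simp_all add: one mult)
  \<comment> \<open>Integer exponents allow the criterion to be stated through the difference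
    \<open>j - i\<close>, which may be negative.\<close>
  have "a [^]\<^bsub>Multiplicative_Group.mult_of ?R\<^esub> int i = a [^]\<^bsub>Multiplicative_Group.mult_of ?R\<^esub> int j \<longleftrightarrow> int (G.ord a) dvd int j - int i"
    by (rule G.int_pow_eq[OF a])
  also have "\<dots> \<longleftrightarrow> [i = j] (mod G.ord a)"
    by (simp add: cong_iff_dvd_diff dvd_diff_commute flip: cong_int_iff)
  finally show ?thesis by (simp add: int_pow_int pow)
qed

section \<open>The weight of nonzero codewords and the minimum distance\<close>

theorem mainTheorem1:
  fixes g :: "'k::{field,finite} poly"
    and \<alpha> :: "'k alg_closure"
    and q n t :: nat
    and S T :: "nat set"
  assumes "primepow q" and "card (UNIV :: 'k set) = q"
    and "n > 0" and "coprime n q"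
    and "\<alpha> \<noteq> 0"
    and "group.ord (Multiplicative_Group.mult_of (ring_of_type_algebra :: 'k alg_closure ring)) \<alpha> = n"
    and "lead_coeff g = 1" and "g dvd Polynomial.monom 1 n - 1"
    and "S \<subseteq> {0..<n}"
    and "map_poly to_ac g = (\<Prod>i\<in>S. [:- (\<alpha> ^ i), 1:])"
    and "T \<subseteq> S"
    and "1 \<le> t" and "t \<le> n"
    and "\<not> (\<exists>i :: nat \<Rightarrow> nat.
              (\<forall>j<t. \<forall>k<t. j \<noteq> k \<longrightarrow> \<not> [i j = i k] (mod n)) \<and>
              proj_point (vec t (\<lambda>j. \<alpha> ^ i j)) \<in> vanishing_locus T t)"
  shows "(\<forall>c\<in>cyclic_code n g. c \<noteq> 0\<^sub>v n \<longrightarrow> t < weight c)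
         \<and> enat t < min_distance n (cyclic_code n g)"
proof -
  have pow_inj: "\<alpha> ^ i = \<alpha> ^ j \<longleftrightarrow> [i = j] (mod n)" for i j
    using power_eq_iff_cong_ord[OF assms(5)] assms(6) by simp
  have weight: "t < weight c" if c: "c \<in> cyclic_code n g" and c0: "c \<noteq> 0\<^sub>v n" for c
  proof (rule ccontr)
    assume "\<not> t < weight c"
    then have wt: "weight c \<le> t" by simp
    let ?supp = "{i. i < n \<and> c $ i \<noteq> 0}"
    have dim: "dim_vec c = n" using c by (auto simp: cyclic_code_def)
    have "card ?supp \<le> t" using wt by (simp add: weight_def dim)
    moreover have "?supp \<subseteq> {..<n}" by auto
    \<comment> \<open>Padding the support to exactly \<open>t\<close> positions is possible because
      \<open>t \<le> n\<close>.\<close>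
    ultimately obtain P where P: "?supp \<subseteq> P" "P \<subseteq> {..<n}" "card P = t"
      using exists_subset_between[of ?supp t "{..<n}"] \<open>t \<le> n\<close> by auto
    have "finite P" using P(2) by (rule finite_subset) simp
    then obtain i where i: "bij_betw i {0..<t} P"
      using ex_bij_betw_nat_finite P(3) by metis
    have iP: "i j \<in> P" if "j < t" for j
      using i that by (auto simp: bij_betw_def)
    have i_lt: "i j < n" if "j < t" for j using iP[OF that] P(2) by auto
    have i_inj: "i j = i k \<longleftrightarrow> j = k" if "j < t" "k < t" for j k
      using i that by (auto simp: bij_betw_def inj_on_def)
    \<comment> \<open>All positions lie below \<open>n\<close>, so distinct positions are
      incongruent modulo \<open>n\<close>.\<close>
    have distinct: "\<not> [i j = i k] (mod n)" if "j < t" "k < t" "j \<noteq> k" for j k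
      using that i_lt[OF that(1)] i_lt[OF that(2)] i_inj[OF that(1,2)]
      by (simp add: cong_def)
    \<comment> \<open>The root \<open>\<alpha> ^ s\<close> of \<open>g\<close> gives a parity check
      supported on \<open>P\<close>; exchanging the two exponents turns
      \<open>\<alpha> ^ i j\<close> into the node and \<open>s\<close> into the exponent.\<close>
    have check: "(\<Sum>j\<in>{0..<t}. to_ac (c $ i j) * (\<alpha> ^ i j) ^ s) = 0" if "s \<in> T" for s
    proof -
      have "s \<in> S" "finite S" using that assms(9,11) by (auto intro: finite_subset)
      then have "poly (map_poly to_ac g) (\<alpha> ^ s) = 0"
        unfolding assms(10) poly_prod by (intro prod_zero) auto
      then have "(\<Sum>k<n. to_ac (c $ k) * (\<alpha> ^ s) ^ k) = 0"
        by (rule cyclic_code_parity_check[OF c assms(8)])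
      moreover have "(\<Sum>k<n. to_ac (c $ k) * (\<alpha> ^ s) ^ k) = (\<Sum>k\<in>P. to_ac (c $ k) * (\<alpha> ^ s) ^ k)"
        using P by (intro sum.mono_neutral_right) auto
      moreover have "\<dots> = (\<Sum>j\<in>{0..<t}. to_ac (c $ i j) * (\<alpha> ^ s) ^ i j)"
        by (rule sum.reindex_bij_betw[OF i, symmetric])
      ultimately show ?thesis by (simp flip: power_mult add: mult.commute)
    qed
    obtain k where k: "k < n" "c $ k \<noteq> 0"
      using c0 dim by (metis eq_vecI index_zero_vec)
    then have "k \<in> i ` {0..<t}" using P(1) i by (auto simp: bij_betw_def)
    then obtain k0 where k0: "k0 < t" "c $ i k0 \<noteq> 0" using k by auto
    \<comment> \<open>The kernel vector; it is nonzero because some nonzero coordinate of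
      \<open>c\<close> sits at a position in \<open>P\<close>.\<close>
    define w where "w = vec t (\<lambda>j. to_ac (c $ i j))"
    have w0: "w \<noteq> 0\<^sub>v t"
    proof
      assume "w = 0\<^sub>v t"
      then have "w $ k0 = 0" using k0 by simp
      then show False using k0 by (simp add: w_def)
    qed
    let ?p = "vec t (\<lambda>j. \<alpha> ^ i j)"
    \<comment> \<open>\<open>vanishing_locus\<close> asks for vanishing at every representative, so
      an arbitrary scalar multiple \<open>b\<close> of the point is treated.\<close>
    have vanish: "eval_mpoly (vec_index x) (schur_quot U) = 0"
      if U: "U \<subseteq> T" "finite U" "card U = t" and x: "x \<in> proj_point ?p" for U x
    proof (rule eval_schur_quot_eq_0, unfold U(3))
      obtain b where b: "b \<noteq> 0" "x = b \<cdot>\<^sub>v ?p" using x by (auto simp: proj_point_def)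
      have xj: "x $ j = b * \<alpha> ^ i j" if "j < t" for j using b that by simp
      show "inj_on (vec_index x) {..<t}"
        using distinct by (auto simp: inj_on_def xj b pow_inj)
      let ?u = "(!) (sorted_list_of_set U)"
      let ?M = "gen_vandermonde_mat t (vec_index x) ?u"
      have uT: "?u r \<in> T" if "r < t" for r
      proof -
        have "?u r \<in> set (sorted_list_of_set U)" using that U by (intro nth_mem) simp
        then show ?thesis using U by auto
      qed
      have "?M *\<^sub>v w = 0\<^sub>v t"
      proof (rule eq_vecI)
        fix r assume "r < dim_vec (0\<^sub>v t :: 'k alg_closure vec)"
        then have r: "r < t" by simp
        have "(?M *\<^sub>v w) $ r = (\<Sum>j\<in>{0..<t}. (b * \<alpha> ^ i j) ^ ?u r * to_ac (c $ i j))"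
          using r by (simp add: gen_vandermonde_mat_def scalar_prod_def w_def xj)
        \<comment> \<open>Within row \<open>r\<close> all powers have the same exponent, so the
          scalar leaves the sum and a parity check remains.\<close>
        also have "\<dots> = b ^ ?u r * (\<Sum>j\<in>{0..<t}. to_ac (c $ i j) * (\<alpha> ^ i j) ^ ?u r)"
          unfolding sum_distrib_left by (rule sum.cong) (simp_all add: power_mult_distrib)
        also have "\<dots> = 0" using check[OF uT[OF r]] by simp
        finally show "(?M *\<^sub>v w) $ r = 0\<^sub>v t $ r" using r by simp
      qed (simp add: gen_vandermonde_mat_def)
      moreover have "?M \<in> carrier_mat t t" "w \<in> carrier_vec t"
        by (simp_all add: gen_vandermonde_mat_def w_def)
      ultimately show "det ?M = 0" using w0 det_0_iff_vec_prod_zero by blast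
    qed
    have "?p \<noteq> 0\<^sub>v t"
    proof
      assume "?p = 0\<^sub>v t"
      then have "?p $ 0 = 0" using \<open>1 \<le> t\<close> by simp
      then show False using \<open>1 \<le> t\<close> assms(5) by simp
    qed
    then have "proj_point ?p \<in> proj_points t" unfolding proj_points_def by auto
    then have "proj_point ?p \<in> vanishing_locus T t"
      using vanish by (simp add: vanishing_locus_def)
    then show False using assms(14) distinct by blast
  qed
  moreover have "enat t < min_distance n (cyclic_code n g)"
  proof -
    \<comment> \<open>An infimum inherits only non-strict lower bounds, hence the detour through
      \<open>Suc t\<close>; it also covers the zero code, whose distance is infinite.\<close>
    have "enat (Suc t) \<le> min_distance n (cyclic_code n g)"
      unfolding min_distance_def using weight by (intro INF_greatest) (auto simp: Suc_le_eq)
    then show ?thesis by (rule less_le_trans[rotated]) simp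
  qed
  ultimately show ?thesis by blast
qed

end
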